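(* Let $\alpha\in\{231,312\}$ and let $i_n^k(\alpha)$ denote the number of involutions of $\{1,\dots,n\}$ with exactly $k$ fixed points that avoid the pattern $\alpha$. For $n\geq 1$ and $0\leq k\leq n$, $$i_n^k(\alpha)=\begin{cases}2^{\frac{n-k-2}{2}}\left(\binom{\frac{n+k}{2}}{\frac{n-k}{2}}+\binom{\frac{n+k-2}{2}}{\frac{n-k}{2}}\right) & \text{if } n+k \text{ is even},\\ 0 & \text{if } n+k \text{ is odd}.\end{cases}$$
   Context: Permutations are in one-line notation. An involution is a permutation with $\pi^{-1}=\pi$; a fixed point is an $i$ with $\pi_i=i$. For $\alpha\in S_m$, $\pi$ contains $\alpha$ if some subsequence $\pi_{i_1}\cdots\pi_{i_m}$ ($i_1<\dots<i_m$) is order-isomorphic to $\alpha$; otherwise $\pi$ avoids $\alpha$. Binomial coefficients $\binom{a}{b}$ with integer $a$ and $b$ are taken as $1$ if $b=0$ and $0$ if $b<0$ or $b>a\geq 0$ (in particular $\binom{a}{b}=0$ when $0\le a<b$). *)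

theory Defs
  imports Complex_Main "HOL-Library.Sublist" "HOL-Combinatorics.Permutations"
begin

text \<open>A permutation of \<open>{1..n}\<close> is a function that \<^const>\<open>permutes\<close> \<open>{1..n}\<close>;
  patterns are given directly by their one-line notation, e.g. \<open>[2, 3, 1]\<close>.\<close>

definition one_line :: "nat \<Rightarrow> (nat \<Rightarrow> nat) \<Rightarrow> nat list" where
  "one_line n \<pi> = map \<pi> [1..<Suc n]"

definition order_isomorphic :: "nat list \<Rightarrow> nat list \<Rightarrow> bool" where
  "order_isomorphic xs ys \<longleftrightarrow>
     length xs = length ys \<and>
     (\<forall>a<length xs. \<forall>b<length xs. xs ! a < xs ! b \<longleftrightarrow> ys ! a < ys ! b)"

definition contains :: "nat list \<Rightarrow> nat list \<Rightarrow> bool" where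
  "contains w \<alpha> \<longleftrightarrow> (\<exists>\<sigma>. subseq \<sigma> w \<and> order_isomorphic \<sigma> \<alpha>)"

abbreviation avoids :: "nat list \<Rightarrow> nat list \<Rightarrow> bool" where
  "avoids w \<alpha> \<equiv> \<not> contains w \<alpha>"

definition involution_on :: "nat \<Rightarrow> (nat \<Rightarrow> nat) \<Rightarrow> bool" where
  "involution_on n \<pi> \<longleftrightarrow> \<pi> permutes {1..n} \<and> inv \<pi> = \<pi>"

text \<open>Fixed points are counted inside \<open>{1..n}\<close> only: the function \<open>\<pi>\<close> is the identity
  outside this set.\<close>

definition fixed_points :: "nat \<Rightarrow> (nat \<Rightarrow> nat) \<Rightarrow> nat set" where
  "fixed_points n \<pi> = {i \<in> {1..n}. \<pi> i = i}"

definition num_avoiding_involutions :: "nat \<Rightarrow> nat \<Rightarrow> nat list \<Rightarrow> nat" where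
  "num_avoiding_involutions n k \<alpha> =
     card {\<pi>. involution_on n \<pi> \<and> card (fixed_points n \<pi>) = k \<and> avoids (one_line n \<pi>) \<alpha>}"

end

theory Submission
  imports Defs
begin

text \<open>An involution contains 231 iff it contains 312, as the two patterns are inverse to each
  other. A 312-avoiding involution \<open>\<pi>\<close> of \<open>{1..n}\<close> with \<open>\<pi> n = j\<close> reverses \<open>{j..n}\<close>, since an
  ascent there would form a 312 together with \<open>\<pi> j = n\<close>; the remaining part is an arbitrary
  312-avoiding involution of \<open>{1..j - 1}\<close>, and the reversed block has a fixed point iff its length
  is odd. Comparing the resulting sums over \<open>j\<close> for \<open>n + 2\<close> and \<open>n\<close> gives
  \<open>c (n + 2) k = 2 * c n k + c (n + 1) (k - 1)\<close> for \<open>n \<ge> 1\<close>, which the closed formula satisfies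
  by Pascal's rule.\<close>

section \<open>Patterns of length three as triples of positions\<close>

lemma subseq_Cons_iff_nth:
  "subseq (x # xs) w \<longleftrightarrow> (\<exists>i<length w. w ! i = x \<and> subseq xs (drop (Suc i) w))"
proof
  assume "subseq (x # xs) w"
  then obtain us vs where "w = us @ x # vs" "subseq xs vs"
    by (auto dest: list_emb_ConsD)
  then show "\<exists>i<length w. w ! i = x \<and> subseq xs (drop (Suc i) w)"
    by (intro exI[of _ "length us"]) auto
next
  assume "\<exists>i<length w. w ! i = x \<and> subseq xs (drop (Suc i) w)"
  then obtain i where i: "i < length w" "w ! i = x" "subseq xs (drop (Suc i) w)" by blast
  then have "w = take i w @ x # drop (Suc i) w" by (metis id_take_nth_drop)
  moreover have "subseq (x # xs) (take i w @ x # drop (Suc i) w)"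
    using i(3) by (simp add: list_emb_append2)
  ultimately show "subseq (x # xs) w" by metis
qed

lemma subseq_triple_iff:
  "subseq [x, y, z] w \<longleftrightarrow> (\<exists>a b c. a < b \<and> b < c \<and> c < length w \<and> w ! a = x \<and> w ! b = y \<and> w ! c = z)"
  (is "?L \<longleftrightarrow> ?R")
proof
  assume ?L
  then obtain a b c where "a < length w" "w ! a = x" "b < length w - Suc a" "w ! (Suc a + b) = y"
    "c < length w - Suc (Suc a + b)" "w ! (Suc (Suc a + b) + c) = z"
    by (auto simp: subseq_Cons_iff_nth add_ac)
  then show ?R
    \<comment> \<open>Each unfolding counts positions from the start of the remaining suffix, so the
      offsets are added up to absolute indices.\<close>
    by (intro exI[of _ a] exI[of _ "Suc a + b"] exI[of _ "Suc (Suc a + b) + c"]) auto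
next
  assume ?R
  then obtain a b c where h: "a < b" "b < c" "c < length w" "w ! a = x" "w ! b = y" "w ! c = z"
    by blast
  define b' c' where "b' = b - Suc a" and "c' = c - Suc b"
  have e: "b = Suc a + b'" "c = Suc b + c'" using h by (auto simp: b'_def c'_def)
  have "subseq [z] (drop (Suc b) w)"
    unfolding subseq_Cons_iff_nth using h e(2) by (intro exI[of _ c']) auto
  then have "subseq [y, z] (drop (Suc a) w)"
    unfolding subseq_Cons_iff_nth[of y] using h e(1) by (intro exI[of _ b']) (auto simp: add_ac)
  then show ?L
    unfolding subseq_Cons_iff_nth[of x] using h by (intro exI[of _ a]) auto
qed

lemma contains_one_line_triple_iff:
  "contains (one_line n \<pi>) [x, y, z] \<longleftrightarrow>
    (\<exists>a b c. 1 \<le> a \<and> a < b \<and> b < c \<and> c \<le> n \<and> order_isomorphic [\<pi> a, \<pi> b, \<pi> c] [x, y, z])"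
  (is "?L \<longleftrightarrow> ?R")
proof
  assume ?L
  then obtain \<sigma> where s: "subseq \<sigma> (one_line n \<pi>)" and o: "order_isomorphic \<sigma> [x, y, z]"
    unfolding contains_def by blast
  from o have "length \<sigma> = 3" by (simp add: order_isomorphic_def)
  then obtain p q r where e: "\<sigma> = [p, q, r]"
    by (auto simp: numeral_3_eq_3 length_Suc_conv)
  from s obtain a b c where h: "a < b" "b < c" "c < n"
    "one_line n \<pi> ! a = p" "one_line n \<pi> ! b = q" "one_line n \<pi> ! c = r"
    unfolding e subseq_triple_iff by (auto simp: one_line_def simp del: upt_Suc)
  then have "p = \<pi> (Suc a)" "q = \<pi> (Suc b)" "r = \<pi> (Suc c)"
    by (auto simp: one_line_def simp del: upt_Suc)
  \<comment> \<open>List indices start at 0, arguments of \<open>\<pi>\<close> at 1.\<close>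
  then show ?R using o h unfolding e
    by (intro exI[of _ "Suc a"] exI[of _ "Suc b"] exI[of _ "Suc c"]) auto
next
  assume ?R
  then obtain a b c where h: "1 \<le> a" "a < b" "b < c" "c \<le> n"
    and o: "order_isomorphic [\<pi> a, \<pi> b, \<pi> c] [x, y, z]" by blast
  have "subseq [\<pi> a, \<pi> b, \<pi> c] (one_line n \<pi>)"
    unfolding subseq_triple_iff using h
    by (intro exI[of _ "a - 1"] exI[of _ "b - 1"] exI[of _ "c - 1"])
      (auto simp: one_line_def simp del: upt_Suc)
  then show ?L using o unfolding contains_def by blast
qed

lemma order_isomorphic_triple_iff:
  "order_isomorphic [p, q, r] [x, y, z] \<longleftrightarrow>
    (p < q \<longleftrightarrow> x < y) \<and> (q < p \<longleftrightarrow> y < x) \<and> (p < r \<longleftrightarrow> x < z) \<and> (r < p \<longleftrightarrow> z < x) \<and>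
    (q < r \<longleftrightarrow> y < z) \<and> (r < q \<longleftrightarrow> z < y)"
  by (auto simp: order_isomorphic_def less_Suc_eq all_conj_distrib)

lemma contains_312_iff:
  "contains (one_line n \<pi>) [3, 1, 2] \<longleftrightarrow>
    (\<exists>a b c. 1 \<le> a \<and> a < b \<and> b < c \<and> c \<le> n \<and> \<pi> b < \<pi> c \<and> \<pi> c < \<pi> a)"
  unfolding contains_one_line_triple_iff order_isomorphic_triple_iff
  by (intro iff_exI) auto

lemma contains_231_iff:
  "contains (one_line n \<pi>) [2, 3, 1] \<longleftrightarrow>
    (\<exists>a b c. 1 \<le> a \<and> a < b \<and> b < c \<and> c \<le> n \<and> \<pi> c < \<pi> a \<and> \<pi> a < \<pi> b)"
  unfolding contains_one_line_triple_iff order_isomorphic_triple_iff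
  by (intro iff_exI) auto

section \<open>Involutions and the symmetry between 231 and 312\<close>

text \<open>A map that is its own inverse is bijective, so \<open>permutes\<close> reduces to
  pointwise equations.\<close>

lemma involution_on_iff:
  "involution_on n \<pi> \<longleftrightarrow> (\<forall>i. \<pi> (\<pi> i) = i) \<and> (\<forall>i. i \<notin> {1..n} \<longrightarrow> \<pi> i = i)"
proof
  assume "involution_on n \<pi>"
  then show "(\<forall>i. \<pi> (\<pi> i) = i) \<and> (\<forall>i. i \<notin> {1..n} \<longrightarrow> \<pi> i = i)"
    unfolding involution_on_def by (metis permutes_inverses(1) permutes_not_in)
next
  assume h: "(\<forall>i. \<pi> (\<pi> i) = i) \<and> (\<forall>i. i \<notin> {1..n} \<longrightarrow> \<pi> i = i)"
  then have "\<pi> permutes {1..n}" unfolding permutes_def by metis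
  moreover have "inv \<pi> = \<pi>" using h by (intro inv_equality) auto
  ultimately show "involution_on n \<pi>" by (simp add: involution_on_def)
qed

lemma involution_on_mem:
  assumes "involution_on n \<pi>" "1 \<le> i" "i \<le> n"
  shows "1 \<le> \<pi> i" "\<pi> i \<le> n"
  using assms permutes_in_image[of \<pi> "{1..n}" i] by (auto simp: involution_on_def)

lemma involution_contains_231_iff_312:
  assumes "involution_on n \<pi>"
  shows "contains (one_line n \<pi>) [2, 3, 1] \<longleftrightarrow> contains (one_line n \<pi>) [3, 1, 2]"
proof
  have inv: "\<pi> (\<pi> i) = i" for i using assms by (simp add: involution_on_iff)
  {
    assume "contains (one_line n \<pi>) [2, 3, 1]"
    then obtain a b c where "1 \<le> a" "a < b" "b < c" "c \<le> n" "\<pi> c < \<pi> a" "\<pi> a < \<pi> b"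
      unfolding contains_231_iff by blast
    \<comment> \<open>Positions and values swap roles: the positions
      \<open>\<pi> c < \<pi> a < \<pi> b\<close> carry the values \<open>c\<close>,
      \<open>a\<close>, \<open>b\<close>, which form a 312.\<close>
    then show "contains (one_line n \<pi>) [3, 1, 2]"
      unfolding contains_312_iff using involution_on_mem[OF assms]
      by (intro exI[of _ "\<pi> c"] exI[of _ "\<pi> a"] exI[of _ "\<pi> b"]) (auto simp: inv)
  next
    assume "contains (one_line n \<pi>) [3, 1, 2]"
    then obtain a b c where "1 \<le> a" "a < b" "b < c" "c \<le> n" "\<pi> b < \<pi> c" "\<pi> c < \<pi> a"
      unfolding contains_312_iff by blast
    then show "contains (one_line n \<pi>) [2, 3, 1]"
      unfolding contains_231_iff using involution_on_mem[OF assms]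
      by (intro exI[of _ "\<pi> b"] exI[of _ "\<pi> c"] exI[of _ "\<pi> a"]) (auto simp: inv)
  }
qed

definition avoiding_involutions :: "nat \<Rightarrow> (nat \<Rightarrow> nat) set" where
  "avoiding_involutions n = {\<pi>. involution_on n \<pi> \<and> avoids (one_line n \<pi>) [3, 1, 2]}"

lemma num_avoiding_involutions_eq:
  assumes "\<alpha> \<in> {[2, 3, 1], [3, 1, 2]}"
  shows "num_avoiding_involutions n k \<alpha> =
    card {\<pi> \<in> avoiding_involutions n. card (fixed_points n \<pi>) = k}"
proof -
  have "{\<pi>. involution_on n \<pi> \<and> card (fixed_points n \<pi>) = k \<and> avoids (one_line n \<pi>) \<alpha>} =
      {\<pi> \<in> avoiding_involutions n. card (fixed_points n \<pi>) = k}"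
    using assms involution_contains_231_iff_312 by (auto simp: avoiding_involutions_def)
  then show ?thesis by (simp add: num_avoiding_involutions_def)
qed

lemma finite_avoiding_involutions [simp]: "finite (avoiding_involutions n)"
proof (rule finite_subset)
  show "avoiding_involutions n \<subseteq> {\<pi>. \<pi> permutes {1..n}}"
    by (auto simp: avoiding_involutions_def involution_on_def)
qed (simp add: finite_permutations)

section \<open>Splitting off the reversed final block\<close>

text \<open>This is the direct sum of \<open>\<sigma>\<close>, regarded as a permutation of
  \<open>{1..m}\<close>, and the decreasing permutation of length \<open>n - m\<close>.\<close>

definition append_reversal :: "nat \<Rightarrow> nat \<Rightarrow> (nat \<Rightarrow> nat) \<Rightarrow> nat \<Rightarrow> nat" where
  "append_reversal n m \<sigma> i = (if m < i \<and> i \<le> n then n + Suc m - i else \<sigma> i)"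

lemma append_reversal_mem:
  assumes "m < n" "\<sigma> \<in> avoiding_involutions m"
  shows "append_reversal n m \<sigma> \<in> avoiding_involutions n"
proof -
  let ?\<pi> = "append_reversal n m \<sigma>"
  have iv: "involution_on m \<sigma>" and av: "avoids (one_line m \<sigma>) [3, 1, 2]"
    using assms(2) by (auto simp: avoiding_involutions_def)
  have inv: "\<sigma> (\<sigma> i) = i" and out: "\<not> (1 \<le> i \<and> i \<le> m) \<Longrightarrow> \<sigma> i = i" for i
    using iv by (auto simp: involution_on_iff)
  have small: "\<sigma> i \<le> m" if "i \<le> m" for i
    using that involution_on_mem[OF iv, of i] out[of i] by (cases "i = 0") auto
  have "?\<pi> (?\<pi> i) = i" for i
  proof (cases "i \<le> m")
    case True
    then show ?thesis using small[OF True] by (simp add: append_reversal_def inv)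
  next
    case False
    then show ?thesis using assms(1) out[of i] by (auto simp: append_reversal_def)
  qed
  moreover have "?\<pi> i = i" if "i \<notin> {1..n}" for i
    using that assms(1) out[of i] by (auto simp: append_reversal_def)
  ultimately have "involution_on n ?\<pi>" by (simp add: involution_on_iff)
  moreover have "avoids (one_line n ?\<pi>) [3, 1, 2]"
  proof
    assume "contains (one_line n ?\<pi>) [3, 1, 2]"
    then obtain a b c where h: "1 \<le> a" "a < b" "b < c" "c \<le> n" "?\<pi> b < ?\<pi> c" "?\<pi> c < ?\<pi> a"
      unfolding contains_312_iff by blast
    show False
    proof (cases "c \<le> m")
      case True
      then have "contains (one_line m \<sigma>) [3, 1, 2]"
        unfolding contains_312_iff using h
        by (intro exI[of _ a] exI[of _ b] exI[of _ c]) (auto simp: append_reversal_def)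
      then show False using av by blast
    \<comment> \<open>If \<open>c\<close> lies in the block, then either \<open>a\<close> lies in
      the prefix and has a value at most \<open>m\<close>, below that of \<open>c\<close>, or all
      three positions lie in the block, where values decrease.\<close>
    next
      case False
      show False
      proof (cases "a \<le> m")
        case True
        then show False using h False small[OF True] by (auto simp: append_reversal_def)
      next
        case False
        then show False using h by (auto simp: append_reversal_def)
      qed
    qed
  qed
  ultimately show ?thesis by (simp add: avoiding_involutions_def)
qed

lemma avoiding_involution_reverses:
  assumes "\<pi> \<in> avoiding_involutions n" "\<pi> n \<le> i" "i \<le> n" "1 \<le> n"
  shows "\<pi> i = n + \<pi> n - i"
proof -
  have iv: "involution_on n \<pi>" and av: "avoids (one_line n \<pi>) [3, 1, 2]"
    using assms(1) by (auto simp: avoiding_involutions_def)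
  have inv: "\<pi> (\<pi> i) = i" for i using iv by (simp add: involution_on_iff)
  define j where "j = \<pi> n"
  have j: "1 \<le> j" "j \<le> n" "\<pi> j = n"
    using involution_on_mem[OF iv] assms(4) inv by (auto simp: j_def)
  have dec: "\<pi> b < \<pi> a" if "j \<le> a" "a < b" "b \<le> n" for a b
  proof (rule ccontr)
    assume n: "\<not> \<pi> b < \<pi> a"
    have ne: "\<pi> x \<noteq> \<pi> y" if "x \<noteq> y" for x y using that inv by metis
    have lt: "\<pi> a < \<pi> b" using n ne[of a b] that by simp
    have "\<pi> b \<le> n" using involution_on_mem(2)[OF iv, of b] j that by simp
    then have "a \<noteq> j" using lt j by auto
    moreover have "\<pi> b < \<pi> j" using \<open>\<pi> b \<le> n\<close> ne[of b j] j that by auto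
    ultimately have "contains (one_line n \<pi>) [3, 1, 2]"
      unfolding contains_312_iff using that j lt
      by (intro exI[of _ j] exI[of _ a] exI[of _ b]) auto
    then show False using av by blast
  qed
  \<comment> \<open>Strict decrease makes \<open>\<pi> i + i\<close> weakly decreasing on
    \<open>{j..n}\<close>. It equals \<open>n + j\<close> at both ends, since \<open>\<pi>\<close>
    swaps \<open>j\<close> and \<open>n\<close>, hence it is constant.\<close>
  have mono: "\<pi> (a + d) + (a + d) \<le> \<pi> a + a" if "j \<le> a" "a + d \<le> n" for a d
    using that
  proof (induction d)
    case (Suc d)
    then show ?case using dec[of "a + d" "a + Suc d"] by simp
  qed simp
  have "\<pi> i + i \<le> \<pi> j + j" using mono[of j "i - j"] assms(2,3) by (simp add: j_def)
  moreover have "\<pi> n + n \<le> \<pi> i + i" using mono[of i "n - i"] assms(2,3) by (simp add: j_def)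
  ultimately show ?thesis using j by (simp add: j_def)
qed

lemma avoiding_involution_decompose:
  assumes "\<pi> \<in> avoiding_involutions n" "1 \<le> n"
  shows "\<exists>m<n. \<pi> \<in> append_reversal n m ` avoiding_involutions m"
proof -
  have iv: "involution_on n \<pi>" and av: "avoids (one_line n \<pi>) [3, 1, 2]"
    using assms(1) by (auto simp: avoiding_involutions_def)
  have inv: "\<pi> (\<pi> i) = i" and out: "\<not> (1 \<le> i \<and> i \<le> n) \<Longrightarrow> \<pi> i = i" for i
    using iv by (auto simp: involution_on_iff)
  define m where "m = \<pi> n - 1"
  have m: "m < n" "\<pi> n = Suc m"
    using involution_on_mem[OF iv, of n] assms(2) by (auto simp: m_def)
  have rev: "\<pi> i = n + Suc m - i" if "m < i" "i \<le> n" for i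
    using avoiding_involution_reverses[of \<pi> n i] assms m that by simp
  \<comment> \<open>The reversal maps the block into itself, so an involution cannot send a prefix
    position into the block.\<close>
  have small: "\<pi> i \<le> m" if "i \<le> m" for i
  proof (rule ccontr)
    assume "\<not> \<pi> i \<le> m"
    moreover have "\<pi> i \<le> n"
      using involution_on_mem(2)[OF iv, of i] out[of i] that m by (cases "i = 0") auto
    ultimately have "\<pi> (\<pi> i) > m" using rev[of "\<pi> i"] by simp
    then show False using inv that by simp
  qed
  \<comment> \<open>Members of \<open>avoiding_involutions m\<close> are the identity beyond
    \<open>m\<close>, so the restriction is extended by the identity.\<close>
  define \<sigma> where "\<sigma> i = (if i \<le> m then \<pi> i else i)" for i
  have "\<sigma> (\<sigma> i) = i" for i using small inv by (auto simp: \<sigma>_def)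
  moreover have "\<sigma> i = i" if "i \<notin> {1..m}" for i
    using that out[of i] by (auto simp: \<sigma>_def)
  ultimately have "involution_on m \<sigma>" by (simp add: involution_on_iff)
  moreover have "avoids (one_line m \<sigma>) [3, 1, 2]"
  proof
    assume "contains (one_line m \<sigma>) [3, 1, 2]"
    then obtain a b c where "1 \<le> a" "a < b" "b < c" "c \<le> m" "\<sigma> b < \<sigma> c" "\<sigma> c < \<sigma> a"
      unfolding contains_312_iff by blast
    then have "contains (one_line n \<pi>) [3, 1, 2]"
      unfolding contains_312_iff using m
      by (intro exI[of _ a] exI[of _ b] exI[of _ c]) (auto simp: \<sigma>_def)
    then show False using av by blast
  qed
  ultimately have "\<sigma> \<in> avoiding_involutions m" by (simp add: avoiding_involutions_def)
  moreover have "\<pi> = append_reversal n m \<sigma>"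
    using rev out by (auto simp: fun_eq_iff append_reversal_def \<sigma>_def)
  ultimately show ?thesis using m by blast
qed

lemma avoiding_involutions_eq_UN:
  assumes "1 \<le> n"
  shows "avoiding_involutions n = (\<Union>m<n. append_reversal n m ` avoiding_involutions m)"
  using avoiding_involution_decompose append_reversal_mem assms by blast

text \<open>The values overwritten by the block carry no information: both arguments are the
  identity beyond \<open>m\<close>.\<close>

lemma inj_on_append_reversal: "inj_on (append_reversal n m) (avoiding_involutions m)"
proof (rule inj_onI, rule ext)
  fix \<sigma> \<tau> i
  assume h: "\<sigma> \<in> avoiding_involutions m" "\<tau> \<in> avoiding_involutions m"
    "append_reversal n m \<sigma> = append_reversal n m \<tau>"
  then have "append_reversal n m \<sigma> i = append_reversal n m \<tau> i" by simp
  then show "\<sigma> i = \<tau> i"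
    using h(1,2)
    by (cases "i \<le> m") (auto simp: append_reversal_def avoiding_involutions_def involution_on_iff)
qed

section \<open>Counting by fixed points and the recurrence\<close>

lemma card_fixed_points_append_reversal:
  assumes "m < n"
  shows "card (fixed_points n (append_reversal n m \<sigma>)) = card (fixed_points m \<sigma>) + (n - m) mod 2"
proof -
  \<comment> \<open>A fixed point of the block is its midpoint, which is an integer exactly when
    \<open>n - m\<close> is odd.\<close>
  let ?B = "{i. m < i \<and> i \<le> n \<and> 2 * i = n + Suc m}"
  have "fixed_points n (append_reversal n m \<sigma>) = fixed_points m \<sigma> \<union> ?B"
    using assms by (auto simp: fixed_points_def append_reversal_def)
  moreover have "fixed_points m \<sigma> \<inter> ?B = {}" by (auto simp: fixed_points_def)
  moreover have "finite (fixed_points m \<sigma>)" by (simp add: fixed_points_def)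
  moreover have "finite ?B" by simp
  ultimately have "card (fixed_points n (append_reversal n m \<sigma>)) = card (fixed_points m \<sigma>) + card ?B"
    by (simp add: card_Un_disjoint)
  moreover have "card ?B = (n - m) mod 2"
  proof (cases "even (n - m)")
    case True
    then have "?B = {}" using assms by (auto; presburger)
    then show ?thesis using True by (simp add: even_iff_mod_2_eq_zero)
  next
    case False
    then have "?B = {(n + Suc m) div 2}" using assms by (auto; presburger)
    then have "card ?B = 1" by simp
    moreover have "(n - m) mod 2 = 1" using False by presburger
    ultimately show ?thesis by simp
  qed
  ultimately show ?thesis by simp
qed

definition num_fixed :: "nat \<Rightarrow> nat \<Rightarrow> nat" where
  "num_fixed n k = card {\<pi> \<in> avoiding_involutions n. card (fixed_points n \<pi>) = k}"

text \<open>Adding \<open>e\<close> on the left instead of subtracting it from \<open>k\<close>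
  avoids truncation: for \<open>e > k\<close> the count is 0.\<close>

definition num_fixed_plus :: "nat \<Rightarrow> nat \<Rightarrow> nat \<Rightarrow> nat" where
  "num_fixed_plus n e k = card {\<pi> \<in> avoiding_involutions n. card (fixed_points n \<pi>) + e = k}"

lemma num_fixed_plus_eq: "num_fixed_plus n e k = (if e \<le> k then num_fixed n (k - e) else 0)"
proof (cases "e \<le> k")
  case True
  then have "card (fixed_points n \<pi>) + e = k \<longleftrightarrow> card (fixed_points n \<pi>) = k - e" for \<pi>
    by auto
  then show ?thesis using True by (simp add: num_fixed_plus_def num_fixed_def)
qed (auto simp: num_fixed_plus_def)

lemma num_fixed_eq_sum:
  assumes "1 \<le> n"
  shows "num_fixed n k = (\<Sum>m<n. num_fixed_plus m ((n - m) mod 2) k)"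
proof -
  define S where "S m = {\<sigma> \<in> avoiding_involutions m. card (fixed_points m \<sigma>) + (n - m) mod 2 = k}" for m
  have "{\<pi> \<in> avoiding_involutions n. card (fixed_points n \<pi>) = k} =
      (\<Union>m\<in>{..<n}. append_reversal n m ` S m)"
    unfolding avoiding_involutions_eq_UN[OF assms]
    by (auto simp: S_def card_fixed_points_append_reversal)
  moreover have "card (\<Union>m\<in>{..<n}. append_reversal n m ` S m) = (\<Sum>m<n. card (append_reversal n m ` S m))"
  proof (rule card_UN_disjoint)
    show "\<forall>m\<in>{..<n}. finite (append_reversal n m ` S m)" by (simp add: S_def)
    \<comment> \<open>The value at \<open>n\<close> is \<open>Suc p\<close> on one side and
      \<open>Suc q\<close> on the other, so the prefix length can be read off.\<close>
    have "p = q" if "p < n" "q < n" "append_reversal n p \<sigma> = append_reversal n q \<tau>" for p q \<sigma> \<tau>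
      using fun_cong[OF that(3), of n] that(1,2) by (simp add: append_reversal_def)
    then show "\<forall>p\<in>{..<n}. \<forall>q\<in>{..<n}. p \<noteq> q \<longrightarrow>
        append_reversal n p ` S p \<inter> append_reversal n q ` S q = {}"
      by blast
  qed simp
  moreover have "card (append_reversal n m ` S m) = num_fixed_plus m ((n - m) mod 2) k" for m
    unfolding num_fixed_plus_def S_def
    by (rule card_image, rule inj_on_subset[OF inj_on_append_reversal]) auto
  ultimately show ?thesis by (simp add: num_fixed_def)
qed

lemma num_fixed_0: "num_fixed 0 k = (if k = 0 then 1 else 0)"
proof -
  have "avoiding_involutions 0 = {id}"
    by (auto simp: avoiding_involutions_def involution_on_iff contains_312_iff simp del: One_nat_def)
  moreover have "fixed_points 0 \<pi> = {}" for \<pi> by (auto simp: fixed_points_def)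
  ultimately have "{\<pi> \<in> avoiding_involutions 0. card (fixed_points 0 \<pi>) = k} =
      (if k = 0 then {id} else {})" by auto
  then show ?thesis by (simp add: num_fixed_def)
qed

lemma num_fixed_1: "num_fixed (Suc 0) k = (if k = 1 then 1 else 0)"
  by (subst num_fixed_eq_sum) (auto simp: num_fixed_plus_eq num_fixed_0)

text \<open>In the sum for \<open>n + 2\<close>, the terms \<open>m < n\<close> depend on
  \<open>n\<close> only through the parity of \<open>n - m\<close>, so they add up to
  \<open>num_fixed n k\<close> if \<open>n \<ge> 1\<close>. The term \<open>m = n\<close> gives a
  second copy, and \<open>m = n + 1\<close> a block of length 1, which is a fixed point.\<close>

lemma num_fixed_add_2:
  "num_fixed (n + 2) k =
    (if k = 0 then 0 else num_fixed (n + 1) (k - 1)) + (if n = 0 then 1 else 2) * num_fixed n k"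
proof -
  have "num_fixed (n + 2) k = (\<Sum>m<n. num_fixed_plus m ((n + 2 - m) mod 2) k) +
      num_fixed_plus n 0 k + num_fixed_plus (n + 1) 1 k"
    by (subst num_fixed_eq_sum) simp_all
  also have "(\<Sum>m<n. num_fixed_plus m ((n + 2 - m) mod 2) k) =
      (\<Sum>m<n. num_fixed_plus m ((n - m) mod 2) k)"
    by (rule sum.cong) (auto simp: Suc_diff_le)
  \<comment> \<open>For \<open>n = 0\<close> the sum is empty although
    \<open>num_fixed 0 0 = 1\<close>; hence the factor 1 instead of 2 in that case.\<close>
  also have "\<dots> = (if n = 0 then 0 else num_fixed n k)"
    using num_fixed_eq_sum[of n k] by simp
  finally show ?thesis by (auto simp: num_fixed_plus_eq)
qed

section \<open>Vanishing and the closed formula\<close>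

text \<open>Both terms of the recurrence keep the parity of \<open>n + k\<close>, and both stay in
  the range \<open>n < k\<close> once there.\<close>

lemma num_fixed_eq_0:
  assumes "n < k \<or> odd (n + k)"
  shows "num_fixed n k = 0"
  using assms
proof (induction n arbitrary: k rule: less_induct)
  case (less n)
  consider "n = 0" | "n = 1" | p where "n = p + 2"
    by (metis One_nat_def add_2_eq_Suc' not0_implies_Suc)
  then show ?case
  proof cases
    case 3
    have "num_fixed p k = 0" using less 3 by (intro less.IH) auto
    moreover have "num_fixed (p + 1) (k - 1) = 0" if "k \<noteq> 0"
      using less.prems 3 that by (intro less.IH) auto
    ultimately show ?thesis using 3 num_fixed_add_2[of p k] by simp
  qed (use less.prems in \<open>auto simp: num_fixed_0 num_fixed_1 intro: odd_pos\<close>)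
qed

text \<open>Doubling avoids the exponent \<open>- 1\<close> that occurs in the formula for \<open>r = 0\<close>. The case
  \<open>r = k = 0\<close> is excluded because of the truncation \<open>0 - 1 = 0\<close>.\<close>

lemma num_fixed_closed_form:
  assumes "1 \<le> k + r"
  shows "2 * num_fixed (k + 2 * r) k = 2 ^ r * ((k + r choose r) + (k + r - 1 choose r))"
  using assms
proof (induction "k + r" arbitrary: k r rule: less_induct)
  case less
  \<comment> \<open>For \<open>r = Suc q\<close>, both the factor 2 in the recurrence and the
    induction hypothesis at \<open>q\<close> need \<open>k + q \<ge> 1\<close>, so
    \<open>r = 1\<close>, \<open>k = 0\<close> is a separate base case.\<close>
  consider "r = 0" "k = 1" | "r = 0" "k \<ge> 2" | "r = 1" "k = 0" | q where "r = Suc q" "k + q \<ge> 1"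
    using less.prems by (cases "r = 0"; cases "k = 0"; cases "r = 1"; cases "k = 1"; cases r) auto
  then show ?case
  proof cases
    case 1
    then show ?thesis by (simp add: num_fixed_1)
  next
    case 2
    then obtain p where p: "k = p + 2" by (metis add.commute le_Suc_ex)
    \<comment> \<open>On the diagonal only the term that appends a fixed point survives.\<close>
    have "num_fixed p k = 0" using p by (intro num_fixed_eq_0) simp
    moreover have "2 * num_fixed (p + 1) (p + 1) = 2" using less.hyps[of "p + 1" 0] 2 p by simp
    ultimately show ?thesis using num_fixed_add_2[of p k] 2 p by simp
  next
    case 3
    then show ?thesis using num_fixed_add_2[of 0 0] by (simp add: num_fixed_0 numeral_2_eq_2)
  next
    case 4
    have ih: "2 * num_fixed (k + 2 * q) k = 2 ^ q * ((k + q choose q) + (k + q - 1 choose q))"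
      using less.hyps[of k q] 4 by simp
    have rec: "num_fixed (k + 2 * r) k =
        (if k = 0 then 0 else num_fixed (k + 2 * q + 1) (k - 1)) + 2 * num_fixed (k + 2 * q) k"
      using num_fixed_add_2[of "k + 2 * q" k] 4 by (simp add: add_ac)
    show ?thesis
    proof (cases k)
      case 0
      \<comment> \<open>Here the second binomial coefficient is 0 for both \<open>r\<close> and
        \<open>q\<close>, and the count just doubles.\<close>
      then show ?thesis using rec ih 4 by (simp add: binomial_eq_0)
    next
      case (Suc l)
      have "2 * num_fixed (l + 2 * r) l = 2 ^ r * ((l + r choose r) + (l + r - 1 choose r))"
        using less.hyps[of l r] Suc 4 by simp
      moreover have "num_fixed (k + 2 * r) k = num_fixed (l + 2 * r) l + 2 * num_fixed (k + 2 * q) k"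
        using rec Suc 4 by simp
      ultimately have "2 * num_fixed (k + 2 * r) k =
          2 ^ r * ((l + r choose r) + (l + r - 1 choose r)) +
          2 * (2 ^ q * ((k + q choose q) + (k + q - 1 choose q)))"
        using ih by (simp only: distrib_left)
      \<comment> \<open>Pascal's rule is applied twice, with \<open>l + r = k + q\<close> and
        \<open>l + r - 1 = k + q - 1\<close>; the factor \<open>2 * 2 ^ q\<close> is
        \<open>2 ^ r\<close>.\<close>
      also have "\<dots> = 2 ^ r * ((k + r choose r) + (k + r - 1 choose r))"
        using Suc 4 by (cases "l + q") (simp_all add: algebra_simps)
      finally show ?thesis .
    qed
  qed
qed

theorem theorem2p4:
  fixes n k :: nat and \<alpha> :: "nat list"
  assumes "\<alpha> \<in> {[2, 3, 1], [3, 1, 2]}"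
    and "n \<ge> 1" and "k \<le> n"
  shows "real (num_avoiding_involutions n k \<alpha>) =
    (if even (n + k)
     then 2 powi ((int n - int k - 2) div 2) *
       (real (((n + k) div 2) choose ((n - k) div 2)) +
        real (((n + k - 2) div 2) choose ((n - k) div 2)))
     else 0)"
proof -
  have c: "num_avoiding_involutions n k \<alpha> = num_fixed n k"
    using num_avoiding_involutions_eq[OF assms(1)] by (simp add: num_fixed_def)
  show ?thesis
  proof (cases "even (n + k)")
    case False
    then show ?thesis using c num_fixed_eq_0[of n k] by simp
  next
    case True
    then have "even (n - k)" using assms(3) by simp
    then obtain r where "n - k = 2 * r" by (elim evenE)
    then have n: "n = k + 2 * r" using assms(3) by simp
    have "real (2 * num_fixed n k) = real (2 ^ r * ((k + r choose r) + (k + r - 1 choose r)))"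
      using num_fixed_closed_form[of k r] assms(2) n by simp
    then have "real (num_fixed n k) =
        2 ^ r / 2 * (real (k + r choose r) + real (k + r - 1 choose r))"
      by simp
    \<comment> \<open>The integer division is exact, and for \<open>r = 0\<close> the exponent is
      -1, matching \<open>2 ^ 0 / 2\<close>.\<close>
    moreover have "(2::real) powi ((int n - int k - 2) div 2) = 2 ^ r / 2"
    proof -
      have "(int n - int k - 2) div 2 = int r - 1" using n by simp
      then show ?thesis by (simp add: power_int_diff)
    qed
    moreover have "(n + k) div 2 = k + r" "(n - k) div 2 = r" "(n + k - 2) div 2 = k + r - 1"
      using n by auto
    ultimately show ?thesis using c True by (simp only: if_True)
  qed
qed

end
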